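(* Let $A$ and $B$ be affine subspaces of $\mathbb{R}^n$ with nonempty intersection, and let $p\in A\cap B$ be arbitrary but fixed. Put $U_A=A-\{p\}$, $V_B=B-\{p\}$ (linear subspaces), $c_F=c_F(U_A,V_B)\in[0,1)$, and $L=p+(U_A+V_B)$. Then the following hold. (1) For every $x\in\mathbb{R}^n$, the three sequences $\{C_{T_{A,B}}^k(P_A(x))\}_{k\in\mathbb{N}}$, $\{C_{T_{A,B}}^k(P_B(x))\}_{k\in\mathbb{N}}$ and $\{C_{T_{A,B}}^k(P_L(x))\}_{k\in\mathbb{N}}$ converge linearly to $P_{A\cap B}(x)$ with rate at least $c_F$. (2) For every $x\in L$, the sequence $\{C_{T_{A,B}}^k(x)\}_{k\in\mathbb{N}}$ converges linearly to $P_{A\cap B}(x)$ with rate at least $c_F$. (3) For every $x\in\mathbb{R}^n$, the three sequences $\{T_{A,B}^k(P_A(x))\}_{k\in\mathbb{N}}$, $\{T_{A,B}^k(P_B(x))\}_{k\in\mathbb{N}}$ and $\{T_{A,B}^k(P_L(x))\}_{k\in\mathbb{N}}$ converge linearly to $P_{A\cap B}(x)$ with rate $c_F$. Here a sequence $\{s^k\}$ converges linearly to $\bar s$ with rate (at least) $c_F$ if there is a constant $M\ge 0$ such that $\|s^k-\bar s\|\le M\,c_F^k$ for all $k\in\mathbb{N}$.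
   Context: $\mathbb{R}^n$ carries the Euclidean inner product $\langle\cdot,\cdot\rangle$ and norm $\|\cdot\|$. For a nonempty closed convex set $S\subset\mathbb{R}^n$, $P_S$ is the orthogonal projection onto $S$ and $R_S=2P_S-\mathrm{Id}$ is the reflection. For affine subspaces $A,B$, the Douglas--Rachford operator is $T_{A,B}=\frac{1}{2}(\mathrm{Id}+R_BR_A)$. The circumcentering operator $C_{T_{A,B}}:\mathbb{R}^n\to\mathbb{R}^n$ is defined by letting $C_{T_{A,B}}(x)$ be the circumcenter of $\{x,R_A(x),R_BR_A(x)\}$, i.e. the unique point of the affine hull of these three points that is equidistant to all three (it exists and is unique for every $x$ when $A\cap B\neq\emptyset$; if the three points coincide it is $x$, and if there are exactly two distinct points it is their midpoint). Powers denote repeated composition. For linear subspaces $U,V$ of $\mathbb{R}^n$, the cosine of the Friedrichs angle is $$c_F(U,V)=\sup\{\langle u,v\rangle : u\in U\cap(U\cap V)^\perp,\ v\in V\cap(U\cap V)^\perp,\ \|u\|\le 1,\ \|v\|\le 1\}.$$ *)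

theory Defs
  imports "HOL-Analysis.Analysis"
begin

definition reflection :: "'a::euclidean_space set \<Rightarrow> 'a \<Rightarrow> 'a" where
  "reflection S x = 2 *\<^sub>R closest_point S x - x"

definition dr_op :: "'a::euclidean_space set \<Rightarrow> 'a set \<Rightarrow> 'a \<Rightarrow> 'a" where
  "dr_op A B x = (1 / 2) *\<^sub>R (x + reflection B (reflection A x))"

(* Meaningful only when such a point exists and is unique, as it does for the sets
   used in circ_op whenever A and B are affine and meet. *)
definition circumcenter :: "'a::euclidean_space set \<Rightarrow> 'a" where
  "circumcenter S = (THE c. c \<in> affine hull S \<and> (\<exists>r. \<forall>s\<in>S. dist c s = r))"

definition circ_op :: "'a::euclidean_space set \<Rightarrow> 'a set \<Rightarrow> 'a \<Rightarrow> 'a" where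
  "circ_op A B x = circumcenter {x, reflection A x, reflection B (reflection A x)}"

definition friedrichs_cos :: "'a::euclidean_space set \<Rightarrow> 'a set \<Rightarrow> real" where
  "friedrichs_cos U V =
     Sup {u \<bullet> v | u v. u \<in> U \<inter> (U \<inter> V)\<^sup>\<bottom> \<and> v \<in> V \<inter> (U \<inter> V)\<^sup>\<bottom> \<and> norm u \<le> 1 \<and> norm v \<le> 1}"

definition converges_linearly :: "(nat \<Rightarrow> 'a::real_normed_vector) \<Rightarrow> 'a \<Rightarrow> real \<Rightarrow> bool" where
  "converges_linearly s l c \<longleftrightarrow> (\<exists>M\<ge>0. \<forall>k. norm (s k - l) \<le> M * c ^ k)"

end

theory Submission
  imports Defs
begin

text \<open>Fix a point \<open>x\<close>, let \<open>z\<close> be its projection onto \<open>A \<inter> B\<close>, and let \<open>U\<close>, \<open>V\<close> be the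
direction spaces of \<open>A\<close>, \<open>B\<close>. Everything happens on the subspace
\<open>M = (U + V) \<inter> (U \<inter> V)\<^sup>\<bottom>\<close>: all three kinds of starting points differ from \<open>z\<close> by a vector of \<open>M\<close>,
and \<open>z + M\<close> is an affine set that the reflections in \<open>A\<close> and \<open>B\<close> map into itself.

The Douglas--Rachford operator contracts \<open>z + M\<close> towards \<open>z\<close> with the factor \<open>c\<close>, the Friedrichs
cosine. With \<open>z\<close> at the origin,
\<open>T x = P\<^sub>V (P\<^sub>U x) + (I - P\<^sub>V) (I - P\<^sub>U) x\<close> is an orthogonal sum. For \<open>x \<in> M\<close>, the cosine bounds the
first summand by \<open>c \<cdot> \<parallel>P\<^sub>U x\<parallel>\<close> and, because the orthogonal complements of \<open>U\<close> and \<open>V\<close> make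
the same angle as \<open>U\<close> and \<open>V\<close>, also the second one by \<open>c \<cdot> \<parallel>x - P\<^sub>U x\<parallel>\<close>. By Pythagoras
\<open>\<parallel>T x\<parallel> \<le> c \<cdot> \<parallel>x\<parallel>\<close> (\<open>norm_dr_op_le\<close>).

The circumcenter is at least as good: reflections in \<open>A\<close> and \<open>B\<close> preserve the distance to \<open>z\<close>,
so \<open>z\<close> is equidistant from the three points and the circumcenter is the projection of \<open>z\<close> onto
their affine hull (\<open>circumcenter_eq_closest_point\<close>). The affine hull contains \<open>T x\<close>, hence the
circumcenter is no farther from \<open>z\<close> than \<open>T x\<close>. Both operators therefore shrink the distance
to \<open>z\<close> by the factor \<open>c\<close> and stay in \<open>z + M\<close>, and iteration gives the linear rate.\<close>

section \<open>Projections onto affine subspaces\<close>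

lemma closest_point_affine:
  fixes S :: "'a::euclidean_space set"
  assumes S: "affine S" "S \<noteq> {}"
  shows closest_point_affine_mem: "closest_point S x \<in> S"
    and closest_point_affine_orthogonal:
      "\<And>y. y \<in> S \<Longrightarrow> (x - closest_point S x) \<bullet> (y - closest_point S x) = 0"
proof -
  have cl: "closed S" and cv: "convex S"
    using S affine_closed affine_imp_convex by auto
  show mem: "closest_point S x \<in> S"
    using closest_point_in_set[OF cl] S by auto
  let ?q = "closest_point S x"
  fix y assume y: "y \<in> S"
  \<comment> \<open>An affine set contains the mirror image of \<open>y\<close> in the projection, so the variational
    inequality of convex sets holds with both signs.\<close>
  have "2 *\<^sub>R ?q + (-1) *\<^sub>R y \<in> S"
    using mem_affine[OF S(1) mem y, of 2 "-1"] by simp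
  from closest_point_dot[OF cv cl this, of x] closest_point_dot[OF cv cl y, of x]
  show "(x - ?q) \<bullet> (y - ?q) = 0"
    by (simp add: algebra_simps scaleR_2)
qed

lemma closest_point_affine_eqI:
  fixes S :: "'a::euclidean_space set"
  assumes "affine S" "q \<in> S" "\<And>y. y \<in> S \<Longrightarrow> (x - q) \<bullet> (y - q) = 0"
  shows "closest_point S x = q"
proof -
  have "dist x q \<le> dist x y" if "y \<in> S" for y
  proof -
    have "(norm (x - y))\<^sup>2 = (norm (x - q))\<^sup>2 + (norm (y - q))\<^sup>2"
      using assms(3)[OF that]
      by (simp add: power2_norm_eq_inner algebra_simps inner_commute)
    then have "(norm (x - q))\<^sup>2 \<le> (norm (x - y))\<^sup>2" by simp
    then show ?thesis unfolding dist_norm by (rule power2_le_imp_le) simp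
  qed
  then show ?thesis
    using closest_point_unique[of S q x] assms(1,2) affine_closed[of S] affine_imp_convex[of S]
    by simp
qed

lemma closest_point_subspace:
  fixes S :: "'a::euclidean_space set"
  assumes S: "subspace S"
  shows closest_point_subspace_mem: "closest_point S x \<in> S"
    and closest_point_subspace_orthogonal: "\<And>y. y \<in> S \<Longrightarrow> (x - closest_point S x) \<bullet> y = 0"
proof -
  have af: "affine S" "S \<noteq> {}"
    using S subspace_imp_affine subspace_0 by auto
  show mem: "closest_point S x \<in> S"
    using closest_point_affine_mem[OF af] .
  fix y assume "y \<in> S"
  then have "y + closest_point S x \<in> S"
    using S mem subspace_add by blast
  from closest_point_affine_orthogonal[OF af this, of x] show "(x - closest_point S x) \<bullet> y = 0"
    by simp
qed

lemma closest_point_subspace_eqI: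
  fixes S :: "'a::euclidean_space set"
  assumes "subspace S" "q \<in> S" "\<And>y. y \<in> S \<Longrightarrow> (x - q) \<bullet> y = 0"
  shows "closest_point S x = q"
  using assms by (intro closest_point_affine_eqI) (auto simp: subspace_imp_affine subspace_diff)

lemma closest_point_subspace_diff:
  fixes S :: "'a::euclidean_space set"
  assumes S: "subspace S"
  shows "closest_point S (x - y) = closest_point S x - closest_point S y"
proof (rule closest_point_subspace_eqI[OF S])
  show "closest_point S x - closest_point S y \<in> S"
    using closest_point_subspace_mem[OF S] subspace_diff[OF S] by blast
  fix w assume "w \<in> S"
  then show "(x - y - (closest_point S x - closest_point S y)) \<bullet> w = 0"
    using closest_point_subspace_orthogonal[OF S, of w x] closest_point_subspace_orthogonal[OF S, of w y]
    by (simp add: algebra_simps)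
qed

lemma closest_point_affine_translate:
  fixes S :: "'a::euclidean_space set"
  assumes S: "affine S" "z \<in> S"
  shows "closest_point ((\<lambda>a. a - z) ` S) (x - z) = closest_point S x - z"
proof (rule closest_point_subspace_eqI[OF affine_diffs_subspace_subtract[OF S]])
  have ne: "S \<noteq> {}" using S by auto
  show "closest_point S x - z \<in> (\<lambda>a. a - z) ` S"
    using closest_point_affine_mem[OF S(1) ne] by auto
  fix y assume "y \<in> (\<lambda>a. a - z) ` S"
  then obtain a where a: "a \<in> S" "y = a - z" by auto
  from closest_point_affine_orthogonal[OF S(1) ne a(1), of x]
    closest_point_affine_orthogonal[OF S(1) ne S(2), of x]
  show "(x - z - (closest_point S x - z)) \<bullet> y = 0"
    unfolding a(2) by (simp add: algebra_simps)
qed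

lemma reflection_affine_translate:
  fixes S :: "'a::euclidean_space set"
  assumes "affine S" "z \<in> S"
  shows "reflection ((\<lambda>a. a - z) ` S) (x - z) = reflection S x - z"
  by (simp add: reflection_def closest_point_affine_translate[OF assms] scaleR_2)

lemma dr_op_affine_translate:
  fixes A B :: "'a::euclidean_space set"
  assumes "affine A" "affine B" "z \<in> A" "z \<in> B"
  shows "dr_op ((\<lambda>a. a - z) ` A) ((\<lambda>b. b - z) ` B) (x - z) = dr_op A B x - z"
proof -
  have eq: "x - z + (y - z) = (x + y) - 2 *\<^sub>R z" for y
    by (simp add: scaleR_2)
  have "(1 / 2) *\<^sub>R (x - z + (y - z)) = (1 / 2) *\<^sub>R (x + y) - z" for y
    unfolding eq by (simp add: scaleR_diff_right)
  then show ?thesis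
    using assms by (simp add: dr_op_def reflection_affine_translate)
qed

lemma orthogonal_comp_iff_inner: "x \<in> W\<^sup>\<bottom> \<longleftrightarrow> (\<forall>y\<in>W. x \<bullet> y = 0)"
  by (simp add: orthogonal_comp_def orthogonal_def inner_commute)

lemma dist_reflection_affine:
  fixes S :: "'a::euclidean_space set"
  assumes S: "affine S" "z \<in> S"
  shows "dist z (reflection S x) = dist z x"
proof -
  let ?q = "closest_point S x"
  have o: "(x - ?q) \<bullet> (z - ?q) = 0"
    using closest_point_affine_orthogonal[OF S(1) _ S(2)] S by auto
  define d e where "d = z - ?q" and "e = x - ?q"
  have "z - reflection S x = d + e" "z - x = d - e"
    by (simp_all add: reflection_def d_def e_def scaleR_2)
  moreover have "d \<bullet> e = 0" using o by (simp add: d_def e_def inner_commute)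
  then have "(norm (d + e))\<^sup>2 = (norm (d - e))\<^sup>2"
    by (simp add: power2_norm_eq_inner inner_add inner_diff inner_commute)
  ultimately show ?thesis by (simp add: dist_norm)
qed

section \<open>The Friedrichs cosine\<close>

context
  fixes U V :: "'a::euclidean_space set"
  assumes U: "subspace U" and V: "subspace V"
begin

lemma inner_le_friedrichs_cos_unit_ball:
  assumes "u \<in> U \<inter> (U \<inter> V)\<^sup>\<bottom>" "v \<in> V \<inter> (U \<inter> V)\<^sup>\<bottom>" "norm u \<le> 1" "norm v \<le> 1"
  shows "u \<bullet> v \<le> friedrichs_cos U V"
  unfolding friedrichs_cos_def
proof (rule cSup_upper)
  have "u' \<bullet> v' \<le> 1" if "norm u' \<le> 1" "norm v' \<le> 1" for u' v' :: 'a
    using norm_cauchy_schwarz[of u' v'] mult_le_one[OF that(1) norm_ge_zero that(2)] by linarith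
  then show "bdd_above {u \<bullet> v |u v. u \<in> U \<inter> (U \<inter> V)\<^sup>\<bottom> \<and> v \<in> V \<inter> (U \<inter> V)\<^sup>\<bottom> \<and> norm u \<le> 1 \<and> norm v \<le> 1}"
    by (intro bdd_aboveI[of _ 1]) blast
qed (use assms in blast)

lemma friedrichs_cos_attained:
  obtains u v where "u \<in> U \<inter> (U \<inter> V)\<^sup>\<bottom>" "v \<in> V \<inter> (U \<inter> V)\<^sup>\<bottom>" "norm u \<le> 1" "norm v \<le> 1"
    "friedrichs_cos U V = u \<bullet> v"
proof -
  define X where "X = U \<inter> (U \<inter> V)\<^sup>\<bottom>"
  define Y where "Y = V \<inter> (U \<inter> V)\<^sup>\<bottom>"
  have X: "subspace X" and Y: "subspace Y"
    unfolding X_def Y_def by (simp_all add: U V subspace_inter subspace_orthogonal_comp)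
  let ?K = "(X \<inter> cball 0 1) \<times> (Y \<inter> cball 0 1)"
  have cpt: "compact ?K"
    by (intro compact_Times closed_Int_compact closed_subspace X Y compact_cball)
  have "(0, 0) \<in> ?K"
    using X Y subspace_0 by auto
  then have ne: "?K \<noteq> {}" by blast
  have cont: "continuous_on ?K (\<lambda>p. fst p \<bullet> snd p)"
    by (intro continuous_intros)
  from continuous_attains_sup[OF cpt ne cont]
  obtain p where p: "p \<in> ?K" "\<And>q. q \<in> ?K \<Longrightarrow> fst q \<bullet> snd q \<le> fst p \<bullet> snd p"
    by auto
  have "friedrichs_cos U V = fst p \<bullet> snd p"
    unfolding friedrichs_cos_def X_def[symmetric] Y_def[symmetric]
  proof (rule cSup_eq_maximum)
    show "fst p \<bullet> snd p \<in> {u \<bullet> v |u v. u \<in> X \<and> v \<in> Y \<and> norm u \<le> 1 \<and> norm v \<le> 1}"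
      by (intro CollectI exI conjI refl) (use p(1) in auto)
    fix t assume "t \<in> {u \<bullet> v |u v. u \<in> X \<and> v \<in> Y \<and> norm u \<le> 1 \<and> norm v \<le> 1}"
    then obtain u v where "t = u \<bullet> v" "u \<in> X" "v \<in> Y" "norm u \<le> 1" "norm v \<le> 1"
      by blast
    then show "t \<le> fst p \<bullet> snd p" using p(2)[of "(u, v)"] by simp
  qed
  then show thesis
    using that[of "fst p" "snd p"] p(1) unfolding X_def Y_def by (simp add: mem_Times_iff)
qed

lemma friedrichs_cos_nonneg: "0 \<le> friedrichs_cos U V"
proof -
  have "0 \<in> U \<inter> (U \<inter> V)\<^sup>\<bottom>" "0 \<in> V \<inter> (U \<inter> V)\<^sup>\<bottom>"
    by (simp_all add: U V subspace_0 subspace_orthogonal_comp)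
  then show ?thesis
    using inner_le_friedrichs_cos_unit_ball[of 0 0] by simp
qed

text \<open>The supremum is attained by compactness. If its value were \<open>1\<close>, the maximising vectors would
be equal by the equality case of Cauchy--Schwarz, hence a unit vector lying both in \<open>U \<inter> V\<close> and
in its orthogonal complement.\<close>

lemma friedrichs_cos_less_1: "friedrichs_cos U V < 1"
proof -
  obtain u v where uv: "u \<in> U \<inter> (U \<inter> V)\<^sup>\<bottom>" "v \<in> V \<inter> (U \<inter> V)\<^sup>\<bottom>" "norm u \<le> 1" "norm v \<le> 1"
    and eq: "friedrichs_cos U V = u \<bullet> v"
    by (rule friedrichs_cos_attained)
  show ?thesis
  proof (rule ccontr)
    assume "\<not> ?thesis"
    then have ge: "1 \<le> u \<bullet> v" using eq by simp
    have "(norm (u - v))\<^sup>2 = (norm u)\<^sup>2 + (norm v)\<^sup>2 - 2 * (u \<bullet> v)"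
      by (simp add: power2_norm_eq_inner algebra_simps inner_commute)
    also have "\<dots> \<le> 0"
      using ge uv(3,4) power_le_one[of "norm u" 2] power_le_one[of "norm v" 2] by simp
    finally have "u = v" by simp
    then have "u \<bullet> u = 0"
      using uv(1,2) by (simp add: orthogonal_comp_iff_inner)
    then show False using ge \<open>u = v\<close> by simp
  qed
qed

lemma inner_le_friedrichs_cos:
  assumes u: "u \<in> U \<inter> (U \<inter> V)\<^sup>\<bottom>" and v: "v \<in> V \<inter> (U \<inter> V)\<^sup>\<bottom>"
  shows "u \<bullet> v \<le> friedrichs_cos U V * norm u * norm v"
proof (cases "u = 0 \<or> v = 0")
  case False
  have "subspace (U \<inter> (U \<inter> V)\<^sup>\<bottom>)" "subspace (V \<inter> (U \<inter> V)\<^sup>\<bottom>)"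
    by (simp_all add: U V subspace_inter subspace_orthogonal_comp)
  then have "(1 / norm u) *\<^sub>R u \<in> U \<inter> (U \<inter> V)\<^sup>\<bottom>" "(1 / norm v) *\<^sub>R v \<in> V \<inter> (U \<inter> V)\<^sup>\<bottom>"
    using u v subspace_mul by blast+
  moreover have "norm ((1 / norm u) *\<^sub>R u) \<le> 1" "norm ((1 / norm v) *\<^sub>R v) \<le> 1"
    by simp_all
  ultimately have "((1 / norm u) *\<^sub>R u) \<bullet> ((1 / norm v) *\<^sub>R v) \<le> friedrichs_cos U V"
    by (rule inner_le_friedrichs_cos_unit_ball)
  then show ?thesis
    using False by (simp add: field_simps)
qed auto

text \<open>The projection \<open>q\<close> of \<open>u\<close> onto \<open>V\<close> is again orthogonal to \<open>U \<inter> V\<close> and satisfies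
\<open>\<parallel>q\<parallel>\<^sup>2 = u \<bullet> q\<close>, which turns the bilinear bound into a bound on norms.\<close>

lemma norm_closest_point_le_friedrichs_cos:
  assumes u: "u \<in> U" "u \<in> (U \<inter> V)\<^sup>\<bottom>"
  shows "norm (closest_point V u) \<le> friedrichs_cos U V * norm u"
proof -
  let ?q = "closest_point V u"
  have qV: "?q \<in> V" and o: "\<And>y. y \<in> V \<Longrightarrow> (u - ?q) \<bullet> y = 0"
    using closest_point_subspace[OF V] by auto
  have "?q \<in> (U \<inter> V)\<^sup>\<bottom>"
    using o u(2) by (simp add: orthogonal_comp_iff_inner inner_diff_left)
  then have "u \<bullet> ?q \<le> friedrichs_cos U V * norm u * norm ?q"
    using inner_le_friedrichs_cos u qV by blast
  moreover have "u \<bullet> ?q = norm ?q * norm ?q"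
    using o[OF qV] by (simp add: inner_diff flip: power2_norm_eq_inner power2_eq_square)
  ultimately show ?thesis
    using friedrichs_cos_nonneg
    by (cases "?q = 0") auto
qed

end

lemma friedrichs_cos_commute: "friedrichs_cos U V = friedrichs_cos V U"
  unfolding friedrichs_cos_def by (rule arg_cong[where f = Sup]) (auto simp: Int_commute; metis inner_commute)

text \<open>The orthogonal complements of \<open>U\<close> and \<open>V\<close> have the same cosine. A vector \<open>r \<in> U + V\<close>
orthogonal to \<open>U\<close> is \<open>v - P\<^sub>U v\<close> for some \<open>v \<in> V\<close> orthogonal to \<open>U \<inter> V\<close>. With
\<open>q = P\<^sub>U v\<close> and \<open>s = P\<^sub>V q\<close>, Pythagoras gives
\<open>\<parallel>r\<parallel>\<^sup>2 = \<parallel>v\<parallel>\<^sup>2 - \<parallel>q\<parallel>\<^sup>2\<close> and \<open>\<parallel>r - P\<^sub>V r\<parallel>\<^sup>2 = \<parallel>q\<parallel>\<^sup>2 - \<parallel>s\<parallel>\<^sup>2\<close>; the claim follows from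
\<open>\<parallel>q\<parallel> \<le> c \<cdot> \<parallel>v\<parallel>\<close> and \<open>\<parallel>q\<parallel>\<^sup>2 = s \<bullet> v \<le> \<parallel>s\<parallel> \<cdot> \<parallel>v\<parallel>\<close>.\<close>

lemma norm_residual_le_friedrichs_cos:
  fixes U V :: "'a::euclidean_space set"
  assumes U: "subspace U" and V: "subspace V"
    and rsum: "r \<in> {u + v |u v. u \<in> U \<and> v \<in> V}" and rU: "r \<in> U\<^sup>\<bottom>"
  shows "norm (r - closest_point V r) \<le> friedrichs_cos U V * norm r"
proof -
  let ?c = "friedrichs_cos U V"
  obtain u0 v0 where r: "r = u0 + v0" and u0: "u0 \<in> U" and v0: "v0 \<in> V"
    using rsum by auto
  have W: "subspace (U \<inter> V)" using U V subspace_inter by blast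
  define w where "w = closest_point (U \<inter> V) v0"
  define v where "v = v0 - w"
  define q where "q = - (u0 + w)"
  define s where "s = closest_point V q"
  have w: "w \<in> U" "w \<in> V" and wo: "\<And>y. y \<in> U \<inter> V \<Longrightarrow> v \<bullet> y = 0"
    using closest_point_subspace[OF W] unfolding w_def v_def by blast+
  have vV: "v \<in> V" unfolding v_def by (simp add: V v0 w subspace_diff)
  have vW: "v \<in> (V \<inter> U)\<^sup>\<bottom>"
    using wo by (auto simp: orthogonal_comp_iff_inner)
  have qU: "q \<in> U" unfolding q_def using U u0 w by (intro subspace_neg subspace_add)
  have rvq: "r = v - q" by (simp add: r v_def q_def)
  have rU': "r \<bullet> y = 0" if "y \<in> U" for y
    using rU that by (simp add: orthogonal_comp_iff_inner)
  have q: "closest_point U v = q"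
    using rU' rvq by (intro closest_point_subspace_eqI[OF U qU]) auto
  have sV: "s \<in> V" and so: "\<And>y. y \<in> V \<Longrightarrow> (q - s) \<bullet> y = 0"
    using closest_point_subspace[OF V] unfolding s_def by auto
  have Pr: "closest_point V r = v - s"
  proof (rule closest_point_subspace_eqI[OF V])
    show "v - s \<in> V" using V vV sV subspace_diff by blast
    show "(r - (v - s)) \<bullet> y = 0" if "y \<in> V" for y
      using so[OF that] by (simp add: rvq inner_diff)
  qed
  have c0: "0 \<le> ?c" by (rule friedrichs_cos_nonneg[OF U V])
  have qv: "norm q \<le> ?c * norm v"
    using norm_closest_point_le_friedrichs_cos[OF V U vV vW] q
    by (simp add: friedrichs_cos_commute)
  have nr: "(norm r)\<^sup>2 = (norm v)\<^sup>2 - (norm q)\<^sup>2"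
    using rU'[OF qU] unfolding rvq by (simp add: power2_norm_eq_inner inner_diff inner_commute)
  have nd: "(norm (r - closest_point V r))\<^sup>2 = (norm q)\<^sup>2 - (norm s)\<^sup>2"
  proof -
    have "(q - s) \<bullet> s = 0" by (rule so[OF sV])
    moreover have "r - closest_point V r = - (q - s)" unfolding Pr by (simp add: rvq)
    ultimately show ?thesis by (simp add: power2_norm_eq_inner inner_diff inner_commute)
  qed
  have "(norm q)\<^sup>2 = s \<bullet> v"
    using so[OF vV] rU'[OF qU] by (simp add: rvq power2_norm_eq_inner inner_diff inner_commute)
  also have "\<dots> \<le> norm s * norm v" by (rule norm_cauchy_schwarz)
  finally have qsv: "(norm q)\<^sup>2 \<le> norm s * norm v" .
  have "(norm (r - closest_point V r))\<^sup>2 \<le> (?c * norm r)\<^sup>2"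
  proof (cases "v = 0")
    case True
    then have "(norm q)\<^sup>2 \<le> 0" using qsv by simp
    then show ?thesis unfolding nd power_mult_distrib
      by (smt (verit) zero_le_power2 mult_nonneg_nonneg)
  next
    case False
    have "((norm q)\<^sup>2)\<^sup>2 \<le> (norm s * norm v)\<^sup>2"
      using qsv by (intro power_mono) auto
    then have "(norm v)\<^sup>2 * ((norm q)\<^sup>2 - (norm s)\<^sup>2) \<le> (norm q)\<^sup>2 * ((norm v)\<^sup>2 - (norm q)\<^sup>2)"
      by (simp add: algebra_simps power_mult_distrib power2_eq_square[of "(norm q)\<^sup>2"])
    also have "\<dots> \<le> (?c * norm v)\<^sup>2 * ((norm v)\<^sup>2 - (norm q)\<^sup>2)"
      using qv nr by (intro mult_right_mono power_mono) (auto simp flip: nr)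
    also have "\<dots> = (norm v)\<^sup>2 * (?c\<^sup>2 * (norm r)\<^sup>2)"
      by (simp add: nr power_mult_distrib)
    finally show ?thesis
      using False unfolding nd power_mult_distrib by (simp add: mult_le_cancel_left)
  qed
  then show ?thesis
    by (rule power2_le_imp_le) (use c0 in simp)
qed

text \<open>Splitting \<open>x\<close> into \<open>a = P\<^sub>U x\<close> and \<open>r = x - a\<close> gives \<open>T x = P\<^sub>V a + (r - P\<^sub>V r)\<close>. The summands
are orthogonal, and so are \<open>a\<close> and \<open>r\<close>.\<close>

lemma norm_dr_op_le:
  fixes U V :: "'a::euclidean_space set"
  assumes U: "subspace U" and V: "subspace V"
    and xsum: "x \<in> {u + v |u v. u \<in> U \<and> v \<in> V}" and xW: "x \<in> (U \<inter> V)\<^sup>\<bottom>"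
  shows "norm (dr_op U V x) \<le> friedrichs_cos U V * norm x"
proof -
  let ?c = "friedrichs_cos U V" and ?P = "closest_point V"
  define a where "a = closest_point U x"
  define r where "r = x - a"
  have aU: "a \<in> U" and ro: "\<And>y. y \<in> U \<Longrightarrow> r \<bullet> y = 0"
    using closest_point_subspace[OF U] unfolding a_def r_def by auto
  have aW: "a \<in> (U \<inter> V)\<^sup>\<bottom>"
    using xW ro unfolding r_def by (simp add: orthogonal_comp_iff_inner inner_diff_left)
  have rU: "r \<in> U\<^sup>\<bottom>" using ro by (simp add: orthogonal_comp_iff_inner)
  obtain u v where uv: "u \<in> U" "v \<in> V" "x = u + v"
    using xsum by auto
  have "r = (u - a) + v" by (simp add: r_def uv(3))
  then have rsum: "r \<in> {u + v |u v. u \<in> U \<and> v \<in> V}"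
    using uv aU U subspace_diff by blast
  have "reflection U x = a - r"
    by (simp add: reflection_def a_def[symmetric] r_def scaleR_2)
  moreover have "reflection V (a - r) = 2 *\<^sub>R (?P a - ?P r) - (a - r)"
    by (simp add: reflection_def closest_point_subspace_diff[OF V])
  moreover have "x + (2 *\<^sub>R (?P a - ?P r) - (a - r)) = 2 *\<^sub>R (?P a + (r - ?P r))"
    by (simp add: r_def scaleR_2)
  ultimately have T: "dr_op U V x = ?P a + (r - ?P r)"
    unfolding dr_op_def by simp
  have "(r - ?P r) \<bullet> ?P a = 0"
    using closest_point_subspace[OF V] by blast
  then have "(norm (dr_op U V x))\<^sup>2 = (norm (?P a))\<^sup>2 + (norm (r - ?P r))\<^sup>2"
    unfolding T by (subst norm_add_Pythagorean) (auto simp: orthogonal_def inner_commute)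
  also have "\<dots> \<le> (?c * norm a)\<^sup>2 + (?c * norm r)\<^sup>2"
    using norm_closest_point_le_friedrichs_cos[OF U V aU aW]
      norm_residual_le_friedrichs_cos[OF U V rsum rU]
    by (intro add_mono power_mono) auto
  also have "\<dots> = (?c * norm x)\<^sup>2"
  proof -
    have "(norm (a + r))\<^sup>2 = (norm a)\<^sup>2 + (norm r)\<^sup>2"
      using ro[OF aU] by (intro norm_add_Pythagorean) (auto simp: orthogonal_def inner_commute)
    then show ?thesis by (simp add: r_def power_mult_distrib distrib_left)
  qed
  finally show ?thesis
    by (rule power2_le_imp_le) (simp add: friedrichs_cos_nonneg[OF U V])
qed

section \<open>Circumcenters\<close>

text \<open>Any point \<open>z\<close> equidistant from \<open>S\<close>, in the affine hull or not, determines the circumcenter: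
the projection of \<open>z\<close> onto the hull is equidistant by Pythagoras. It is the only such point of the
hull, since the difference of two equidistant points is orthogonal to all differences of points
of \<open>S\<close>.\<close>

lemma circumcenter_eq_closest_point:
  fixes S :: "'a::euclidean_space set"
  assumes ne: "S \<noteq> {}" and eqd: "\<And>s. s \<in> S \<Longrightarrow> dist z s = \<rho>"
  shows "circumcenter S = closest_point (affine hull S) z"
proof -
  let ?H = "affine hull S" and ?q = "closest_point (affine hull S) z"
  have H: "affine ?H" "?H \<noteq> {}" using ne by auto
  have qH: "?q \<in> ?H" and o: "\<And>y. y \<in> ?H \<Longrightarrow> (z - ?q) \<bullet> (y - ?q) = 0"
    using closest_point_affine[OF H] by blast+
  obtain s0 where s0: "s0 \<in> S" using ne by auto
  have eq: "dist ?q s = sqrt (\<rho>\<^sup>2 - (dist z ?q)\<^sup>2)" if s: "s \<in> S" for s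
  proof -
    have "(norm (z - s))\<^sup>2 = (norm (z - ?q))\<^sup>2 + (norm (s - ?q))\<^sup>2"
      using o[OF hull_inc[OF s]] by (simp add: power2_norm_eq_inner algebra_simps inner_commute)
    then have "(dist ?q s)\<^sup>2 = \<rho>\<^sup>2 - (dist z ?q)\<^sup>2"
      using eqd[OF s] by (simp add: dist_norm norm_minus_commute)
    then show ?thesis by (metis real_sqrt_unique zero_le_dist)
  qed
  show ?thesis
    unfolding circumcenter_def
  proof (rule the_equality)
    show "?q \<in> ?H \<and> (\<exists>r. \<forall>s\<in>S. dist ?q s = r)" using qH eq by auto
    fix c assume "c \<in> ?H \<and> (\<exists>r. \<forall>s\<in>S. dist c s = r)"
    then obtain r where cH: "c \<in> ?H" and r: "\<And>s. s \<in> S \<Longrightarrow> dist c s = r" by auto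
    let ?N = "{y. (c - ?q) \<bullet> y = (c - ?q) \<bullet> s0}"
    have "(c - ?q) \<bullet> s = (c - ?q) \<bullet> s0" if s: "s \<in> S" for s
    proof -
      have "(norm (c - s))\<^sup>2 = (norm (c - s0))\<^sup>2" "(norm (?q - s))\<^sup>2 = (norm (?q - s0))\<^sup>2"
        using r[OF s] r[OF s0] eq[OF s] eq[OF s0] by (auto simp: dist_norm)
      then show ?thesis
        by (simp add: power2_norm_eq_inner inner_diff inner_commute)
    qed
    then have "?H \<subseteq> ?N"
      by (intro hull_minimal) (auto simp: affine_hyperplane)
    from subsetD[OF this cH] subsetD[OF this qH]
    have "(c - ?q) \<bullet> (c - ?q) = 0" by (simp add: inner_diff_right)
    then show "c = ?q" by simp
  qed
qed

section \<open>Linear convergence\<close>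

text \<open>The two assumptions on \<open>F\<close> are what the Douglas--Rachford and the circumcentering operator have
in common. The first one keeps the iterates in \<open>N = z + M\<close>, an affine set stable under both
reflections; the second one transfers to \<open>F\<close> the contraction factor that \<open>norm_dr_op_le\<close> gives
on \<open>N\<close>.\<close>

lemma converges_linearly_funpow:
  fixes A B :: "'a::euclidean_space set"
  assumes A: "affine A" "z \<in> A" and B: "affine B" "z \<in> B"
    and U: "U = (\<lambda>a. a - z) ` A" and V: "V = (\<lambda>b. b - z) ` B"
    and hull: "\<And>x. F x \<in> affine hull {x, reflection A x, reflection B (reflection A x)}"
    and dist: "\<And>x. norm (F x - z) \<le> norm (dr_op A B x - z)"
    and x: "x - z \<in> {u + v |u v. u \<in> U \<and> v \<in> V}" "x - z \<in> (U \<inter> V)\<^sup>\<bottom>"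
  shows "converges_linearly (\<lambda>k. (F ^^ k) x) z (friedrichs_cos U V)"
proof -
  let ?c = "friedrichs_cos U V"
  have sU: "subspace U" and sV: "subspace V"
    unfolding U V using A B affine_diffs_subspace_subtract by blast+
  let ?M = "{u + v |u v. u \<in> U \<and> v \<in> V} \<inter> (U \<inter> V)\<^sup>\<bottom>"
  define N where "N = (+) z ` ?M"
  have sM: "subspace ?M"
    by (intro subspace_inter subspace_sums sU sV subspace_orthogonal_comp)
  have N_iff: "y \<in> N \<longleftrightarrow> y - z \<in> ?M" for y
    unfolding N_def by (metis (no_types, lifting) add_diff_cancel_left' image_iff diff_add_cancel add.commute)
  have afN: "affine N"
    unfolding N_def using sM subspace_imp_affine affine_translation by blast
  have refl_M: "reflection S y \<in> ?M"
    if S: "subspace S" "S \<subseteq> {u + v |u v. u \<in> U \<and> v \<in> V}" "U \<inter> V \<subseteq> S" and y: "y \<in> ?M" for S y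
  proof -
    have q: "closest_point S y \<in> S" "\<And>w. w \<in> S \<Longrightarrow> (y - closest_point S y) \<bullet> w = 0"
      using closest_point_subspace[OF S(1)] by blast+
    have "(y - closest_point S y) \<bullet> w = 0" if "w \<in> U \<inter> V" for w
      using q(2) that S(3) by blast
    then have "closest_point S y \<in> (U \<inter> V)\<^sup>\<bottom>"
      using y by (simp add: orthogonal_comp_iff_inner inner_diff_left)
    then have "closest_point S y \<in> ?M" using q(1) S(2) by blast
    then show ?thesis
      unfolding reflection_def using sM y by (intro subspace_diff subspace_mul)
  qed
  have "U \<subseteq> {u + v |u v. u \<in> U \<and> v \<in> V}" "V \<subseteq> {u + v |u v. u \<in> U \<and> v \<in> V}"
    using subspace_0[OF sU] subspace_0[OF sV] by force+
  then have reflA: "reflection A y \<in> N" and reflB: "reflection B y \<in> N" if "y \<in> N" for y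
    using refl_M[OF sU _ _ that[unfolded N_iff]] refl_M[OF sV _ _ that[unfolded N_iff]]
      reflection_affine_translate[OF A, of y] reflection_affine_translate[OF B, of y]
    unfolding N_iff U[symmetric] V[symmetric] by auto
  have FN: "F y \<in> N" if "y \<in> N" for y
  proof -
    have "affine hull {y, reflection A y, reflection B (reflection A y)} \<subseteq> N"
      using that reflA reflB afN by (intro hull_minimal) auto
    then show ?thesis using hull by blast
  qed
  have Fc: "norm (F y - z) \<le> ?c * norm (y - z)" if "y \<in> N" for y
  proof -
    have "norm (F y - z) \<le> norm (dr_op U V (y - z))"
      using dist[of y] dr_op_affine_translate[OF A(1) B(1) A(2) B(2)] unfolding U V by simp
    also have "\<dots> \<le> ?c * norm (y - z)"
      using that unfolding N_iff by (intro norm_dr_op_le sU sV) auto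
    finally show ?thesis .
  qed
  have "(F ^^ k) x \<in> N \<and> norm ((F ^^ k) x - z) \<le> norm (x - z) * ?c ^ k" for k
  proof (induction k)
    case 0
    then show ?case using x by (simp add: N_iff)
  next
    case (Suc k)
    then have "norm (F ((F ^^ k) x) - z) \<le> ?c * norm ((F ^^ k) x - z)" using Fc by blast
    also have "\<dots> \<le> ?c * (norm (x - z) * ?c ^ k)"
      using Suc friedrichs_cos_nonneg[OF sU sV] by (intro mult_left_mono) auto
    finally show ?case using Suc FN by (simp add: ac_simps)
  qed
  then show ?thesis
    unfolding converges_linearly_def by (metis norm_ge_zero)
qed

lemma dr_op_in_affine_hull:
  "dr_op A B x \<in> affine hull {x, reflection A x, reflection B (reflection A x)}"
proof -
  let ?H = "affine hull {x, reflection A x, reflection B (reflection A x)}"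
  have "(1 / 2) *\<^sub>R x + (1 / 2) *\<^sub>R reflection B (reflection A x) \<in> ?H"
    using affine_affine_hull[of "{x, reflection A x, reflection B (reflection A x)}"]
    unfolding affine_def by (simp add: hull_inc)
  then show ?thesis by (simp add: dr_op_def scaleR_add_right)
qed

lemma circ_op_in_affine_hull_and_norm_le:
  fixes A B :: "'a::euclidean_space set"
  assumes A: "affine A" "z \<in> A" and B: "affine B" "z \<in> B"
  shows "circ_op A B x \<in> affine hull {x, reflection A x, reflection B (reflection A x)}"
    and "norm (circ_op A B x - z) \<le> norm (dr_op A B x - z)"
proof -
  let ?S = "{x, reflection A x, reflection B (reflection A x)}"
  have eq: "circ_op A B x = closest_point (affine hull ?S) z"
    unfolding circ_op_def
    by (rule circumcenter_eq_closest_point[where \<rho> = "dist z x"])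
      (auto simp: dist_reflection_affine A B)
  show "circ_op A B x \<in> affine hull ?S"
    unfolding eq by (intro closest_point_affine_mem) auto
  have "dist z (closest_point (affine hull ?S) z) \<le> dist z (dr_op A B x)"
    by (intro closest_point_le dr_op_in_affine_hull closed_affine_hull)
  then show "norm (circ_op A B x - z) \<le> norm (dr_op A B x - z)"
    by (simp add: eq dist_norm norm_minus_commute)
qed

text \<open>Independence of the base point allows the origin to be moved from the arbitrary \<open>p\<close> to the
limit of the iteration.\<close>

lemma affine_diffs_base_change:
  assumes A: "affine A" "p \<in> A" "z \<in> A"
  shows "(\<lambda>a. a - p) ` A = (\<lambda>a. a - z) ` A"
proof -
  have "(\<lambda>a. a - p) ` A \<subseteq> (\<lambda>a. a - z) ` A" if "p \<in> A" "z \<in> A" for p z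
  proof
    fix d assume "d \<in> (\<lambda>a. a - p) ` A"
    then obtain a where a: "a \<in> A" "d = a - p" by auto
    have "a - p + z \<in> A"
      using mem_affine_3_minus[OF A(1) \<open>z \<in> A\<close> a(1) \<open>p \<in> A\<close>, of 1] by (simp add: algebra_simps)
    then show "d \<in> (\<lambda>a. a - z) ` A"
      unfolding a(2) by (metis (no_types, lifting) add_diff_cancel image_eqI)
  qed
  then show ?thesis using A by blast
qed

theorem corollary2p13:
  fixes A B U V L :: "(real ^ 'n) set" and p :: "real ^ 'n" and c :: real
  assumes "affine A" and "affine B" and "p \<in> A \<inter> B"
    and "U = (\<lambda>a. a - p) ` A"
    and "V = (\<lambda>b. b - p) ` B"
    and "c = friedrichs_cos U V"
    and "L = {p + (u + v) | u v. u \<in> U \<and> v \<in> V}"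
  shows "(0 \<le> c \<and> c < 1)
     \<and> (\<forall>x. converges_linearly (\<lambda>k. (circ_op A B ^^ k) (closest_point A x)) (closest_point (A \<inter> B) x) c
           \<and> converges_linearly (\<lambda>k. (circ_op A B ^^ k) (closest_point B x)) (closest_point (A \<inter> B) x) c
           \<and> converges_linearly (\<lambda>k. (circ_op A B ^^ k) (closest_point L x)) (closest_point (A \<inter> B) x) c)
     \<and> (\<forall>x\<in>L. converges_linearly (\<lambda>k. (circ_op A B ^^ k) x) (closest_point (A \<inter> B) x) c)
     \<and> (\<forall>x. converges_linearly (\<lambda>k. (dr_op A B ^^ k) (closest_point A x)) (closest_point (A \<inter> B) x) c
           \<and> converges_linearly (\<lambda>k. (dr_op A B ^^ k) (closest_point B x)) (closest_point (A \<inter> B) x) c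
           \<and> converges_linearly (\<lambda>k. (dr_op A B ^^ k) (closest_point L x)) (closest_point (A \<inter> B) x) c)"
proof -
  note A = assms(1) and B = assms(2)
  have pA: "p \<in> A" and pB: "p \<in> B" using assms(3) by auto
  have sU: "subspace U" and sV: "subspace V"
    unfolding assms(4,5) using A B pA pB affine_diffs_subspace_subtract by blast+
  let ?S = "{u + v |u v. u \<in> U \<and> v \<in> V}"
  have sS: "subspace ?S" by (intro subspace_sums sU sV)
  have L: "L = (+) p ` ?S" unfolding assms(7) by auto
  have L_iff: "y \<in> L \<longleftrightarrow> y - p \<in> ?S" for y
    unfolding L by (metis (no_types, lifting) add_diff_cancel_left' image_iff diff_add_cancel add.commute)
  have afL: "affine L" unfolding L using sS subspace_imp_affine affine_translation by blast
  have afI: "affine (A \<inter> B)" using A B affine_Int by blast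
  have "U \<subseteq> ?S" "V \<subseteq> ?S" using subspace_0[OF sU] subspace_0[OF sV] by force+
  then have AL: "A \<subseteq> L" and BL: "B \<subseteq> L"
    unfolding subset_iff L_iff assms(4,5) by auto

  \<comment> \<open>It suffices that the starting point \<open>y\<close> lies in \<open>L\<close> and has the same projection onto
    \<open>A \<inter> B\<close> as \<open>x\<close>, expressed by orthogonality of \<open>x - y\<close> to \<open>A \<inter> B\<close>.\<close>
  have conv: "converges_linearly (\<lambda>k. (circ_op A B ^^ k) y) (closest_point (A \<inter> B) x) c
      \<and> converges_linearly (\<lambda>k. (dr_op A B ^^ k) y) (closest_point (A \<inter> B) x) c"
    if y: "y \<in> L" and orth: "\<And>a b. a \<in> A \<inter> B \<Longrightarrow> b \<in> A \<inter> B \<Longrightarrow> (x - y) \<bullet> (a - b) = 0" for x y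
  proof -
    define z where "z = closest_point (A \<inter> B) x"
    have ne: "A \<inter> B \<noteq> {}" using assms(3) by auto
    have z: "z \<in> A" "z \<in> B" and zo: "\<And>a. a \<in> A \<inter> B \<Longrightarrow> (x - z) \<bullet> (a - z) = 0"
      using closest_point_affine[OF afI ne] unfolding z_def by blast+
    have U: "U = (\<lambda>a. a - z) ` A" and V: "V = (\<lambda>b. b - z) ` B"
      unfolding assms(4,5) using affine_diffs_base_change A B pA pB z by blast+
    have "z - p \<in> ?S" "y - p \<in> ?S" using z AL y L_iff by blast+
    from subspace_diff[OF sS this(2) this(1)] have 1: "y - z \<in> ?S" by simp
    have 2: "y - z \<in> (U \<inter> V)\<^sup>\<bottom>"
      unfolding orthogonal_comp_iff_inner
    proof
      fix w assume "w \<in> U \<inter> V"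
      then have w: "w + z \<in> A \<inter> B" unfolding U V by auto
      show "(y - z) \<bullet> w = 0"
        using zo[OF w] orth[OF w, of z] z by (simp add: inner_diff_left)
    qed
    have "converges_linearly (\<lambda>k. (circ_op A B ^^ k) y) z (friedrichs_cos U V)"
      by (rule converges_linearly_funpow[OF A z(1) B z(2) U V _ _ 1 2])
        (use circ_op_in_affine_hull_and_norm_le[OF A z(1) B z(2)] in blast)+
    moreover have "converges_linearly (\<lambda>k. (dr_op A B ^^ k) y) z (friedrichs_cos U V)"
      by (rule converges_linearly_funpow[OF A z(1) B z(2) U V dr_op_in_affine_hull order_refl 1 2])
    ultimately show ?thesis unfolding z_def assms(6) by blast
  qed
  have conv_closest: "converges_linearly (\<lambda>k. (circ_op A B ^^ k) (closest_point S x)) (closest_point (A \<inter> B) x) c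
      \<and> converges_linearly (\<lambda>k. (dr_op A B ^^ k) (closest_point S x)) (closest_point (A \<inter> B) x) c"
    if S: "affine S" "S \<subseteq> L" "A \<inter> B \<subseteq> S" for S x
  proof (rule conv)
    have "S \<noteq> {}" using S(3) assms(3) by blast
    note cp = closest_point_affine[OF S(1) this]
    show "closest_point S x \<in> L" using cp(1) S(2) by blast
    fix a b assume "a \<in> A \<inter> B" "b \<in> A \<inter> B"
    then have "(x - closest_point S x) \<bullet> (a - closest_point S x) = 0"
      "(x - closest_point S x) \<bullet> (b - closest_point S x) = 0"
      using cp(2) S(3) by blast+
    then show "(x - closest_point S x) \<bullet> (a - b) = 0" by (simp add: inner_diff_right)
  qed
  have "0 \<le> c" "c < 1"
    unfolding assms(6) using friedrichs_cos_nonneg[OF sU sV] friedrichs_cos_less_1[OF sU sV] by auto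
  moreover have "converges_linearly (\<lambda>k. (circ_op A B ^^ k) x) (closest_point (A \<inter> B) x) c"
    if "x \<in> L" for x
    using conv[OF that, of x] by simp
  ultimately show ?thesis
    using conv_closest[OF A AL] conv_closest[OF B BL] conv_closest[OF afL order_refl] AL by blast
qed

end
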